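(* Let $G$ and $G'$ be structures over the same vocabulary with maximum relation arity $2$. If $G$ and $G'$ are non-isomorphic and have the same order $n$, then $\mathrm{D}_1(G,G')\le (n+3)/2$.
   Context: A vocabulary is a finite sequence of relation symbols with positive integer arities; maximum relation arity $2$ means that all symbols are unary or binary (binary relations are arbitrary, loops allowed). Structures are finite; the order of a structure is the number of elements of its universe. First order formulas use the relation symbols of the vocabulary, $=$, and the connectives $\neg,\wedge,\vee$. A closed formula $\Phi$ distinguishes $G$ from $G'$ if it is true on $G$ and false on $G'$. The set $\mathrm{Nest}(\Phi)$ of sequences of nested quantifiers is defined inductively: $\mathrm{Nest}(\Phi)=\{\epsilon\}$ (the empty word) for atomic $\Phi$; $\mathrm{Nest}(\neg\Phi)$ is obtained from $\mathrm{Nest}(\Phi)$ by exchanging $\exists$ and $\forall$ in all words; $\mathrm{Nest}(\Phi\wedge\Psi)=\mathrm{Nest}(\Phi\vee\Psi)=\mathrm{Nest}(\Phi)\cup\mathrm{Nest}(\Psi)$; $\mathrm{Nest}(\exists x\Phi)$ and $\mathrm{Nest}(\forall x\Phi)$ are obtained by prepending $\exists$, respectively $\forall$, to every word of $\mathrm{Nest}(\Phi)$. The quantifier rank of $\Phi$ is the maximum length of a word in $\mathrm{Nest}(\Phi)$; the alternation number of $\Phi$ is the maximum, over words in $\mathrm{Nest}(\Phi)$, of the number of occurrences of $\exists\forall$ and $\forall\exists$ as consecutive letters. $\mathrm{D}_1(G,G')$ is the minimum quantifier rank of a formula with alternation number at most $1$ distinguishing $G$ from $G'$. *)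

theory Defs
  imports Complex_Main "HOL-Library.Extended_Real"
begin

text \<open>A vocabulary is the list of arities of its relation symbols; the symbols themselves are
  the indices into that list.\<close>

type_synonym vocab = "nat list"

definition vocabulary :: "vocab \<Rightarrow> bool" where
  "vocabulary \<sigma> \<longleftrightarrow> (\<forall>k\<in>set \<sigma>. 0 < k)"

record 'a struct =
  univ :: "'a set"
  interp :: "nat \<Rightarrow> 'a list set"

definition is_structure :: "vocab \<Rightarrow> 'a struct \<Rightarrow> bool" where
  "is_structure \<sigma> G \<longleftrightarrow> finite (univ G) \<and>
     (\<forall>i<length \<sigma>. interp G i \<subseteq> {xs. length xs = \<sigma> ! i \<and> set xs \<subseteq> univ G})"

abbreviation order_of :: "'a struct \<Rightarrow> nat" where
  "order_of G \<equiv> card (univ G)"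

definition isomorphic :: "vocab \<Rightarrow> 'a struct \<Rightarrow> 'b struct \<Rightarrow> bool" where
  "isomorphic \<sigma> G G' \<longleftrightarrow> (\<exists>f. bij_betw f (univ G) (univ G') \<and>
     (\<forall>i<length \<sigma>. \<forall>xs. length xs = \<sigma> ! i \<and> set xs \<subseteq> univ G \<longrightarrow>
        (xs \<in> interp G i \<longleftrightarrow> map f xs \<in> interp G' i)))"

datatype fm =
    Eq nat nat
  | Rel nat "nat list"
  | Neg fm
  | Conj fm fm
  | Disj fm fm
  | Exi nat fm
  | Uni nat fm

primrec fm_over :: "vocab \<Rightarrow> fm \<Rightarrow> bool" where
  "fm_over \<sigma> (Eq x y) = True"
| "fm_over \<sigma> (Rel i xs) = (i < length \<sigma> \<and> length xs = \<sigma> ! i)"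
| "fm_over \<sigma> (Neg \<phi>) = fm_over \<sigma> \<phi>"
| "fm_over \<sigma> (Conj \<phi> \<psi>) = (fm_over \<sigma> \<phi> \<and> fm_over \<sigma> \<psi>)"
| "fm_over \<sigma> (Disj \<phi> \<psi>) = (fm_over \<sigma> \<phi> \<and> fm_over \<sigma> \<psi>)"
| "fm_over \<sigma> (Exi x \<phi>) = fm_over \<sigma> \<phi>"
| "fm_over \<sigma> (Uni x \<phi>) = fm_over \<sigma> \<phi>"

primrec free_vars :: "fm \<Rightarrow> nat set" where
  "free_vars (Eq x y) = {x, y}"
| "free_vars (Rel i xs) = set xs"
| "free_vars (Neg \<phi>) = free_vars \<phi>"
| "free_vars (Conj \<phi> \<psi>) = free_vars \<phi> \<union> free_vars \<psi>"
| "free_vars (Disj \<phi> \<psi>) = free_vars \<phi> \<union> free_vars \<psi>"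
| "free_vars (Exi x \<phi>) = free_vars \<phi> - {x}"
| "free_vars (Uni x \<phi>) = free_vars \<phi> - {x}"

abbreviation closed_fm :: "fm \<Rightarrow> bool" where
  "closed_fm \<phi> \<equiv> free_vars \<phi> = {}"

primrec sat :: "'a struct \<Rightarrow> (nat \<Rightarrow> 'a) \<Rightarrow> fm \<Rightarrow> bool" where
  "sat G e (Eq x y) = (e x = e y)"
| "sat G e (Rel i xs) = (map e xs \<in> interp G i)"
| "sat G e (Neg \<phi>) = (\<not> sat G e \<phi>)"
| "sat G e (Conj \<phi> \<psi>) = (sat G e \<phi> \<and> sat G e \<psi>)"
| "sat G e (Disj \<phi> \<psi>) = (sat G e \<phi> \<or> sat G e \<psi>)"
| "sat G e (Exi x \<phi>) = (\<exists>a\<in>univ G. sat G (e(x := a)) \<phi>)"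
| "sat G e (Uni x \<phi>) = (\<forall>a\<in>univ G. sat G (e(x := a)) \<phi>)"

lemma sat_cong_free_vars:
  "(\<And>x. x \<in> free_vars \<phi> \<Longrightarrow> e x = e' x) \<Longrightarrow> sat G e \<phi> = sat G e' \<phi>"
proof (induction \<phi> arbitrary: e e')
  case (Eq x y)
  then show ?case by simp
next
  case (Rel i xs)
  then have "map e xs = map e' xs" by simp
  then show ?case by (simp only: sat.simps)
next
  case (Neg \<phi>)
  from Neg.IH[of e e'] Neg.prems show ?case by simp
next
  case (Conj \<phi> \<psi>)
  from Conj.IH(1)[of e e'] Conj.IH(2)[of e e'] Conj.prems show ?case by simp
next
  case (Disj \<phi> \<psi>)
  from Disj.IH(1)[of e e'] Disj.IH(2)[of e e'] Disj.prems show ?case by simp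
next
  case (Exi x \<phi>)
  have "sat G (e(x := a)) \<phi> = sat G (e'(x := a)) \<phi>" for a
    by (rule Exi.IH) (simp add: Exi.prems)
  then show ?case by simp
next
  case (Uni x \<phi>)
  have "sat G (e(x := a)) \<phi> = sat G (e'(x := a)) \<phi>" for a
    by (rule Uni.IH) (simp add: Uni.prems)
  then show ?case by simp
qed

text \<open>Truth of a closed formula: by \<open>sat_cong_free_vars\<close> the assignment is irrelevant,
  so a dummy one is used.\<close>

definition true_on :: "'a struct \<Rightarrow> fm \<Rightarrow> bool" where
  "true_on G \<phi> \<longleftrightarrow> sat G (\<lambda>_. undefined) \<phi>"

definition distinguishes :: "vocab \<Rightarrow> fm \<Rightarrow> 'a struct \<Rightarrow> 'b struct \<Rightarrow> bool" where
  "distinguishes \<sigma> \<phi> G G' \<longleftrightarrow>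
     fm_over \<sigma> \<phi> \<and> closed_fm \<phi> \<and> true_on G \<phi> \<and> \<not> true_on G' \<phi>"

datatype quant = QE | QA

primrec dual :: "quant \<Rightarrow> quant" where
  "dual QE = QA"
| "dual QA = QE"

primrec Nest :: "fm \<Rightarrow> quant list set" where
  "Nest (Eq x y) = {[]}"
| "Nest (Rel i xs) = {[]}"
| "Nest (Neg \<phi>) = map dual ` Nest \<phi>"
| "Nest (Conj \<phi> \<psi>) = Nest \<phi> \<union> Nest \<psi>"
| "Nest (Disj \<phi> \<psi>) = Nest \<phi> \<union> Nest \<psi>"
| "Nest (Exi x \<phi>) = (#) QE ` Nest \<phi>"
| "Nest (Uni x \<phi>) = (#) QA ` Nest \<phi>"

lemma finite_Nest [simp]: "finite (Nest \<phi>)"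
  and Nest_nonempty [simp]: "Nest \<phi> \<noteq> {}"
  by (induction \<phi>) auto

definition alternations :: "quant list \<Rightarrow> nat" where
  "alternations w = card {i. Suc i < length w \<and> w ! i \<noteq> w ! Suc i}"

definition quantifier_rank :: "fm \<Rightarrow> nat" where
  "quantifier_rank \<phi> = Max (length ` Nest \<phi>)"

definition alternation_number :: "fm \<Rightarrow> nat" where
  "alternation_number \<phi> = Max (alternations ` Nest \<phi>)"

text \<open>The minimum is taken in \<^typ>\<open>enat\<close>, so that it is infinite when no formula with the
  required properties exists.\<close>

definition D :: "nat \<Rightarrow> vocab \<Rightarrow> 'a struct \<Rightarrow> 'b struct \<Rightarrow> enat" where
  "D k \<sigma> G G' =
     (INF \<phi> \<in> {\<phi>. distinguishes \<sigma> \<phi> G G' \<and> alternation_number \<phi> \<le> k}.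
        enat (quantifier_rank \<phi>))"

end

theory Submission
  imports Defs "HOL-Library.FuncSet"
begin

text \<open>
  Choose a set \<open>X\<close> of elements of \<open>G\<close>, as large as possible, whose adjacency types partition the
  other elements into more than \<open>|X|\<close> classes. Then \<open>2 |X| + 1 \<le> n\<close>, and by maximality no element
  whose class is not a singleton separates two further elements of the same class. Spoiler first
  picks \<open>X\<close>; whatever Duplicator's answer is, he then wins within \<open>b = \<lfloor>(n + 3) / 2\<rfloor> - |X|\<close> further
  moves, all in \<open>G\<close> or all in \<open>G'\<close>, so the quantifiers alternate at most once.

  Indeed, suppose that Duplicator survives \<open>b\<close> moves in either structure. Classes over \<open>X\<close> have
  the same size in \<open>G\<close> and \<open>G'\<close>: otherwise some class is too small on one side and another too
  small on the other, and Spoiler wins by picking one element more than the smaller count; as the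
  counts sum to at most \<open>n - 2 |X| + 1\<close>, one of the two attempts fits in \<open>b\<close> moves. Singleton
  classes are thereby matched, and the same count inside one class, with one move kept for
  exhibiting a mismatch, shows that the types over \<open>X\<close> and the singleton classes also have equal
  multiplicities. By homogeneity of the other classes, any bijection respecting these types is an
  isomorphism.
\<close>

section \<open>Partial isomorphisms and the one-sided game\<close>

definition partial_iso :: "('a \<Rightarrow> 'a \<Rightarrow> 'c) \<Rightarrow> ('b \<Rightarrow> 'b \<Rightarrow> 'c) \<Rightarrow> ('a \<times> 'b) set \<Rightarrow> bool" where
  "partial_iso t t' P \<longleftrightarrow>
     (\<forall>u u' v v'. (u, u') \<in> P \<longrightarrow> (v, v') \<in> P \<longrightarrow> (u = v \<longleftrightarrow> u' = v') \<and> t u v = t' u' v')"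

text \<open>Duplicator, answering in \<open>V'\<close>, survives \<open>b\<close> moves of Spoiler made in \<open>V\<close>.\<close>

primrec survives ::
    "('a \<Rightarrow> 'a \<Rightarrow> 'c) \<Rightarrow> 'a set \<Rightarrow> ('b \<Rightarrow> 'b \<Rightarrow> 'c) \<Rightarrow> 'b set \<Rightarrow> nat \<Rightarrow> ('a \<times> 'b) set \<Rightarrow> bool" where
  "survives t V t' V' 0 P = partial_iso t t' P"
| "survives t V t' V' (Suc b) P = (\<forall>a\<in>V. \<exists>a'\<in>V'. survives t V t' V' b (insert (a, a') P))"

lemma partial_isoD:
  assumes "partial_iso t t' P" "(u, u') \<in> P" "(v, v') \<in> P"
  shows "u = v \<longleftrightarrow> u' = v'" "t u v = t' u' v'"
  using assms(1)[unfolded partial_iso_def, rule_format, OF assms(2,3)] by simp_all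

lemma partial_isoI:
  assumes "\<And>u u' v v'. (u, u') \<in> P \<Longrightarrow> (v, v') \<in> P \<Longrightarrow> (u = v \<longleftrightarrow> u' = v') \<and> t u v = t' u' v'"
  shows "partial_iso t t' P"
  unfolding partial_iso_def by (intro allI impI assms)

lemma partial_iso_mono:
  assumes "partial_iso t t' P" "Q \<subseteq> P"
  shows "partial_iso t t' Q"
  by (rule partial_isoI) (simp add: partial_isoD[OF assms(1)] subsetD[OF assms(2)])

lemma converse_insert: "(insert (a, b) R)\<inverse> = insert (b, a) (R\<inverse>)"
  by auto

lemma partial_iso_converseD:
  assumes "partial_iso t t' P"
  shows "partial_iso t' t (P\<inverse>)"
proof (rule partial_isoI)
  fix u u' v v' assume "(u, u') \<in> P\<inverse>" "(v, v') \<in> P\<inverse>"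
  then have "(u', u) \<in> P" "(v', v) \<in> P" by simp_all
  from partial_isoD[OF assms this] show "(u = v \<longleftrightarrow> u' = v') \<and> t' u v = t u' v'" by simp
qed

lemma partial_iso_converse: "partial_iso t' t (P\<inverse>) = partial_iso t t' P"
  using partial_iso_converseD[of t' t "P\<inverse>"] partial_iso_converseD[of t t' P] by auto

lemma survives_mono: "survives t V t' V' b P \<Longrightarrow> Q \<subseteq> P \<Longrightarrow> survives t V t' V' b Q"
proof (induction b arbitrary: P Q)
  case 0
  then show ?case using partial_iso_mono by auto
next
  case (Suc b)
  show ?case
  proof (simp, intro ballI)
    fix a assume "a \<in> V"
    then obtain a' where "a' \<in> V'" "survives t V t' V' b (insert (a, a') P)"
      using Suc.prems(1) by auto
    moreover have "insert (a, a') Q \<subseteq> insert (a, a') P" using Suc.prems(2) by blast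
    ultimately show "\<exists>a'\<in>V'. survives t V t' V' b (insert (a, a') Q)" using Suc.IH by blast
  qed
qed

text \<open>Spoiler may waste surplus moves, provided that he can move at all: for
  \<open>V = {}\<close> any positive number of moves is survived vacuously.\<close>

lemma survives_le:
  assumes "survives t V t' V' b P" "V \<noteq> {}" "c \<le> b"
  shows "survives t V t' V' c P"
  using assms(3,1)
proof (induction rule: inc_induct)
  case base
  then show ?case .
next
  case (step m)
  then have "survives t V t' V' (Suc m) P" by blast
  moreover obtain a where "a \<in> V" using assms(2) by blast
  ultimately obtain a' where "survives t V t' V' m (insert (a, a') P)" by auto
  then show ?case using survives_mono by blast
qed

lemma survives_partial_iso:
  "survives t V t' V' b P \<Longrightarrow> V \<noteq> {} \<Longrightarrow> partial_iso t t' P"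
  using survives_le[of t V t' V' b P 0] by simp

text \<open>Each element of \<open>A\<close> is played once, so the replies can be recorded as a
  function.\<close>

lemma survives_block:
  assumes "finite A" "A \<subseteq> V" "survives t V t' V' (card A + b) P"
  shows "\<exists>g. g ` A \<subseteq> V' \<and> survives t V t' V' b (P \<union> (\<lambda>a. (a, g a)) ` A)"
  using assms
proof (induction A arbitrary: P rule: finite_induct)
  case empty
  then show ?case by simp
next
  case (insert a A)
  from insert have "survives t V t' V' (Suc (card A + b)) P" by simp
  then obtain a' where a': "a' \<in> V'" "survives t V t' V' (card A + b) (insert (a, a') P)"
    using insert.prems(1) by auto
  then obtain g where g: "g ` A \<subseteq> V'"
      "survives t V t' V' b (insert (a, a') P \<union> (\<lambda>a. (a, g a)) ` A)"
    using insert.IH insert.prems(1) by blast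
  have "insert (a, a') P \<union> (\<lambda>a. (a, g a)) ` A
      = P \<union> (\<lambda>x. (x, (g(a := a')) x)) ` insert a A"
    using insert.hyps by auto
  moreover have "(g(a := a')) ` insert a A \<subseteq> V'" using g(1) a'(1) by auto
  ultimately show ?case using g(2) by metis
qed

text \<open>Spoiler picks \<open>min (card B) m\<close> elements of \<open>B\<close> and keeps
  \<open>j\<close> moves in reserve. The replies are distinct because the position reached is a
  partial isomorphism, and each of them alone withstands \<open>j\<close> more moves, so
  \<open>reply\<close> puts it into \<open>B'\<close>.\<close>

lemma survives_count:
  assumes surv: "survives t V t' V' (m + j) P"
    and "V \<noteq> {}" "B \<subseteq> V" "finite B" "finite B'"
    and reply: "\<And>a a'. a \<in> B \<Longrightarrow> a' \<in> V' \<Longrightarrow> survives t V t' V' j (insert (a, a') P) \<Longrightarrow> a' \<in> B'"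
  shows "min (card B) m \<le> card B'"
proof -
  obtain A where A: "A \<subseteq> B" "card A = min (card B) m" "finite A"
    by (rule obtain_subset_with_card_n[of "min (card B) m" B]) auto
  have "survives t V t' V' (card A + j) P"
    using survives_le[OF surv \<open>V \<noteq> {}\<close>] A(2) by simp
  then obtain g where g: "g ` A \<subseteq> V'" "survives t V t' V' j (P \<union> (\<lambda>a. (a, g a)) ` A)"
    using survives_block[OF A(3)] A(1) assms(3) by blast
  have iso: "partial_iso t t' (P \<union> (\<lambda>a. (a, g a)) ` A)"
    by (rule survives_partial_iso[OF g(2) assms(2)])
  have "inj_on g A"
  proof (rule inj_onI)
    fix a c assume "a \<in> A" "c \<in> A" "g a = g c"
    then show "a = c" using partial_isoD(1)[OF iso, of a "g a" c "g c"] by blast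
  qed
  moreover have "g ` A \<subseteq> B'"
  proof (rule image_subsetI)
    fix a assume "a \<in> A"
    then have "insert (a, g a) P \<subseteq> P \<union> (\<lambda>a. (a, g a)) ` A" by blast
    then have "survives t V t' V' j (insert (a, g a) P)" by (rule survives_mono[OF g(2)])
    then show "g a \<in> B'" using reply[of a "g a"] g(1) \<open>a \<in> A\<close> A(1) by blast
  qed
  ultimately show ?thesis by (metis A(2) assms(5) card_image card_mono)
qed

section \<open>Counting fibres and classes\<close>

lemma card_eq_sum_fibres:
  assumes "finite A" "f ` A \<subseteq> T" "finite T"
  shows "card A = (\<Sum>d\<in>T. card {a \<in> A. f a = d})"
  using sum.group[OF assms(1,3,2), of "\<lambda>_. 1::nat"] by simp

text \<open>The fibre sizes have equal sums, so a deficit at one value is offset by an excess at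
  another.\<close>

lemma fibre_imbalance:
  assumes "finite A" "finite B" "card A = card B"
    and "card {a \<in> A. f a = c} \<noteq> card {b \<in> B. g b = c}"
  obtains d e where "card {a \<in> A. f a = d} < card {b \<in> B. g b = d}"
    and "card {b \<in> B. g b = e} < card {a \<in> A. f a = e}"
proof -
  let ?F = "\<lambda>d. card {a \<in> A. f a = d}" and ?G = "\<lambda>d. card {b \<in> B. g b = d}"
  let ?T = "insert c (f ` A \<union> g ` B)"
  have sums: "sum ?F ?T = sum ?G ?T"
    using card_eq_sum_fibres[of A f ?T] card_eq_sum_fibres[of B g ?T] assms
    by (simp add: subset_insertI2)
  have fin: "finite ?T" using assms by auto
  have "\<exists>d\<in>?T. ?F d < ?G d"
  proof (rule ccontr)
    assume "\<not> ?thesis"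
    then have le: "\<forall>d\<in>?T. ?G d \<le> ?F d" by (meson linorder_not_less)
    moreover have "?G c < ?F c" using le assms(4) by force
    ultimately have "sum ?G ?T < sum ?F ?T" by (intro sum_strict_mono_ex1 fin) auto
    then show False using sums by simp
  qed
  moreover have "\<exists>d\<in>?T. ?G d < ?F d"
  proof (rule ccontr)
    assume "\<not> ?thesis"
    then have le: "\<forall>d\<in>?T. ?F d \<le> ?G d" by (meson linorder_not_less)
    moreover have "?F c < ?G c" using le assms(4) by force
    ultimately have "sum ?F ?T < sum ?G ?T" by (intro sum_strict_mono_ex1 fin) auto
    then show False using sums by simp
  qed
  ultimately show ?thesis using that by blast
qed

lemma fibrewise_bij:
  assumes "finite A" "finite B"
    and "\<And>d. card {a \<in> A. f a = d} = card {b \<in> B. g b = d}"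
  obtains F where "bij_betw F A B" "\<And>a. a \<in> A \<Longrightarrow> g (F a) = f a"
proof -
  have "\<forall>d. \<exists>\<beta>. bij_betw \<beta> {a \<in> A. f a = d} {b \<in> B. g b = d}"
    using assms by (intro allI finite_same_card_bij) auto
  then obtain \<beta> where \<beta>: "\<And>d. bij_betw (\<beta> d) {a \<in> A. f a = d} {b \<in> B. g b = d}" by metis
  define F where "F a = \<beta> (f a) a" for a
  have F: "F a \<in> B" "g (F a) = f a" if "a \<in> A" for a
    using bij_betw_apply[OF \<beta>[of "f a"], of a] that by (auto simp: F_def)
  have "inj_on F A"
  proof (rule inj_onI)
    fix a a' assume a: "a \<in> A" "a' \<in> A" "F a = F a'"
    then have "f a = f a'" using F(2) by metis
    then show "a = a'"
      using a bij_betw_imp_inj_on[OF \<beta>[of "f a"]] by (auto simp: F_def inj_on_def)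
  qed
  moreover have "F ` A = B"
  proof (intro equalityI image_subsetI subsetI)
    fix b assume "b \<in> B"
    then have "b \<in> \<beta> (g b) ` {a \<in> A. f a = g b}" using bij_betw_imp_surj_on[OF \<beta>[of "g b"]] by auto
    then show "b \<in> F ` A" by (force simp: F_def)
  qed (rule F(1))
  ultimately show ?thesis using that F(2) by (simp add: bij_betw_def)
qed

text \<open>Each added element creates at most one new value of \<open>f\<close>, so the surplus of
  elements over values grows with the set. A lower bound on the number of classes of
  \<open>S\<close> thus bounds the joint size of any few of them.\<close>

lemma card_image_surplus:
  assumes "finite S" "A \<subseteq> S"
  shows "card A + card (f ` S) \<le> card S + card (f ` A)"
proof -
  have "f ` S = f ` A \<union> f ` (S - A)" using assms by auto
  then have "card (f ` S) \<le> card (f ` A) + card (f ` (S - A))" by (simp add: card_Un_le)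
  also have "card (f ` (S - A)) \<le> card (S - A)" using assms by (simp add: card_image_le)
  also have "card (S - A) = card S - card A" using assms by (meson card_Diff_subset finite_subset)
  finally show ?thesis using card_mono[OF assms] by simp
qed

section \<open>Profiles and the choice of the base set\<close>

definition profile :: "('a \<Rightarrow> 'a \<Rightarrow> 'c) \<Rightarrow> 'a set \<Rightarrow> 'a \<Rightarrow> 'c \<times> ('a \<Rightarrow> 'c)" where
  "profile t X v = (t v v, restrict (t v) X)"

text \<open>\<open>X\<close> is a largest set with more classes than elements. Adding a violating
  \<open>u\<close> would lose no class, since \<open>w\<close> keeps that of \<open>u\<close>, and
  would separate \<open>v\<^sub>1\<close> from \<open>v\<^sub>2\<close>; the larger set would
  qualify too.\<close>

lemma profile_base:
  fixes t :: "'a \<Rightarrow> 'a \<Rightarrow> 'c"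
  assumes "finite V" "V \<noteq> {}"
  obtains X where "X \<subseteq> V" "card X < card (profile t X ` (V - X))"
    and "\<And>u w v\<^sub>1 v\<^sub>2. \<lbrakk>{u, w, v\<^sub>1, v\<^sub>2} \<subseteq> V - X; u \<notin> {w, v\<^sub>1, v\<^sub>2};
          profile t X u = profile t X w; profile t X v\<^sub>1 = profile t X v\<^sub>2\<rbrakk> \<Longrightarrow> t v\<^sub>1 u = t v\<^sub>2 u"
proof -
  let ?N = "\<lambda>X. card (profile t X ` (V - X))"
  let ?good = "\<lambda>X. X \<subseteq> V \<and> card X < ?N X"
  have "?good {}" using assms by (simp add: card_gt_0_iff)
  then obtain X where X: "?good X" and max: "\<And>Y. ?good Y \<Longrightarrow> card Y \<le> card X"
    using ex_has_greatest_nat[of ?good "{}" card "Suc (card V)"] assms(1)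
    by (auto simp: less_Suc_eq_le card_mono)
  have "t v\<^sub>1 u = t v\<^sub>2 u"
    if in_S: "{u, w, v\<^sub>1, v\<^sub>2} \<subseteq> V - X" and ne: "u \<notin> {w, v\<^sub>1, v\<^sub>2}"
      and eq: "profile t X u = profile t X w" "profile t X v\<^sub>1 = profile t X v\<^sub>2" for u w v\<^sub>1 v\<^sub>2
  proof (rule ccontr)
    assume split: "t v\<^sub>1 u \<noteq> t v\<^sub>2 u"
    let ?X = "insert u X"
    let ?B = "profile t ?X ` (V - ?X)"
    \<comment> \<open>Forgetting the colour towards \<open>u\<close> turns profiles over the larger
      set into profiles over \<open>X\<close>. This map reaches every old class and identifies two
      new ones.\<close>
    define \<rho> where "\<rho> = (\<lambda>(c :: 'c, g :: 'a \<Rightarrow> 'c). (c, restrict g X))"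
    have \<rho>: "\<rho> (profile t ?X v) = profile t X v" for v
      by (auto simp: \<rho>_def profile_def restrict_def)
    have "profile t X ` (V - X) \<subseteq> \<rho> ` ?B"
    proof (rule image_subsetI)
      fix v assume v: "v \<in> V - X"
      show "profile t X v \<in> \<rho> ` ?B"
      proof (cases "v = u")
        case True
        then have "profile t X v = \<rho> (profile t ?X w)" using \<rho> eq by simp
        then show ?thesis using in_S ne by blast
      next
        case False
        then show ?thesis using v \<rho>[of v] by (metis (no_types) Diff_iff image_eqI insert_iff)
      qed
    qed
    then have "?N X \<le> card (\<rho> ` ?B)" using assms(1) by (intro card_mono) auto
    moreover have "card (\<rho> ` ?B) < card ?B"
    proof -
      have "profile t ?X v\<^sub>1 \<noteq> profile t ?X v\<^sub>2"
        using split by (auto simp: profile_def restrict_def fun_eq_iff)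
      moreover have "\<rho> (profile t ?X v\<^sub>1) = \<rho> (profile t ?X v\<^sub>2)" using \<rho> eq by simp
      moreover have "v\<^sub>1 \<in> V - ?X" "v\<^sub>2 \<in> V - ?X" using in_S ne by auto
      ultimately have "\<not> inj_on \<rho> ?B" by (meson imageI inj_onD)
      moreover have "finite ?B" using assms(1) by simp
      ultimately show ?thesis using card_image_le eq_card_imp_inj_on le_neq_implies_less by blast
    qed
    ultimately have "Suc (card X) < ?N ?X" using X by simp
    moreover have card_X: "card ?X = Suc (card X)"
      using X in_S assms(1) by (auto dest: finite_subset)
    ultimately have good: "?good ?X" using X in_S by simp
    show False using max[OF good] card_X by simp
  qed
  then show ?thesis by (rule that[OF conjunct1[OF X] conjunct2[OF X]])
qed


section \<open>From Duplicator's survival to an isomorphism\<close>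

text \<open>\<open>h\<close> is Duplicator's answer to \<open>X\<close>. Survival is assumed for
  each side separately because Spoiler, having played \<open>X\<close>, makes all remaining moves in
  one structure. By \<open>sw\<close>, the colour of a pair determines that of the reversed
  pair.\<close>

lemma survives_imp_iso:
  fixes t :: "'a \<Rightarrow> 'a \<Rightarrow> 'c" and t' :: "'b \<Rightarrow> 'b \<Rightarrow> 'c"
  assumes fin: "finite V" "finite V'" and card_V: "card V = card V'"
    and X: "X \<subseteq> V" "card X < card (profile t X ` (V - X))"
    and homog: "\<And>u w v\<^sub>1 v\<^sub>2. \<lbrakk>{u, w, v\<^sub>1, v\<^sub>2} \<subseteq> V - X; u \<notin> {w, v\<^sub>1, v\<^sub>2};
          profile t X u = profile t X w; profile t X v\<^sub>1 = profile t X v\<^sub>2\<rbrakk> \<Longrightarrow> t v\<^sub>1 u = t v\<^sub>2 u"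
    and sw: "\<And>u v. t v u = sw (t u v)" "\<And>u v. t' v u = sw (t' u v)"
    and h: "h ` X \<subseteq> V'"
    and P_def: "P = (\<lambda>x. (x, h x)) ` X"
    and b: "card V + 2 \<le> 2 * card X + 2 * b"
    and surv: "survives t V t' V' b P" "survives t' V' t V b (P\<inverse>)"
  shows "\<exists>f. bij_betw f V V' \<and> (\<forall>u\<in>V. \<forall>v\<in>V. t' (f u) (f v) = t u v)"
proof -
  define S S' where "S = V - X" and "S' = V' - h ` X"
  \<comment> \<open>Indexing by \<open>x\<close> rather than by \<open>h x\<close> makes the
    profiles of the two sides directly comparable.\<close>
  define pL pR where "pL = profile t X"
    and "pR v' = (t' v' v', restrict (\<lambda>x. t' v' (h x)) X)" for v'
  define C C' where "C p = {v \<in> S. pL v = p}" and "C' p = {v' \<in> S'. pR v' = p}" for p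
  have ne: "V \<noteq> {}" using X by auto
  then have ne': "V' \<noteq> {}" using card_V fin by auto
  have finX: "finite X" and finS: "finite S" "finite S'"
    using X fin finite_subset by (auto simp: S_def S'_def)
  have finC: "finite (C p)" "finite (C' p)" for p using finS by (auto simp: C_def C'_def)
  have SV: "S \<subseteq> V" "S' \<subseteq> V'" by (auto simp: S_def S'_def)
  have card_S: "card V = card X + card S" using X fin finX
    by (metis S_def card_Diff_subset card_mono le_add_diff_inverse)
  have many: "card X < card (pL ` S)" using X(2) by (simp add: pL_def S_def)
  have "card (pL ` S) \<le> card S" using finS by (simp add: card_image_le)
  \<comment> \<open>\<open>card V\<close> is at least \<open>2 * card X + 1\<close>, so
    \<open>2 * b\<close> is at least 3.\<close>
  with many card_S b have b2: "2 \<le> b" by presburger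

  have iso0: "partial_iso t t' P" by (rule survives_partial_iso[OF surv(1) ne])
  have P_mem: "(x, h x) \<in> P" if "x \<in> X" for x using that by (simp add: P_def)
  have inj_h: "inj_on h X"
  proof (rule inj_onI)
    fix x y assume "x \<in> X" "y \<in> X" "h x = h y"
    then show "x = y" using partial_isoD(1)[OF iso0 P_mem P_mem] by blast
  qed
  have card_S': "card S' = card S"
    unfolding S'_def using card_S card_V
    by (simp add: card_Diff_subset[OF finite_imageI[OF finX] h] card_image[OF inj_h])
  have conv: "partial_iso t' t (insert (a', a) (R\<inverse>)) = partial_iso t t' (insert (a, a') R)"
    for a a' R
    using partial_iso_converse[of t' t "insert (a, a') R"] unfolding converse_insert .
  have conv2: "partial_iso t' t (insert (c', c) (insert (a', a) (R\<inverse>)))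
      = partial_iso t t' (insert (c, c') (insert (a, a') R))" for a a' c c' R
    using conv[of c' c "insert (a, a') R"] unfolding converse_insert .
  have same: "(a \<in> S \<longleftrightarrow> a' \<in> S') \<and> pL a = pR a'"
    if iso: "partial_iso t t' (insert (a, a') P)" and "a \<in> V" "a' \<in> V'" for a a'
  proof -
    have "a = x \<longleftrightarrow> a' = h x" "t a x = t' a' (h x)" if "x \<in> X" for x
      using partial_isoD[OF iso, of a a' x "h x"] P_mem[OF that] by simp_all
    moreover have "t a a = t' a' a'" using partial_isoD(2)[OF iso, of a a' a a'] by simp
    ultimately show ?thesis
      using that(2,3) by (auto simp: S_def S'_def pL_def pR_def profile_def restrict_def)
  qed

  have "min (card (C p)) b \<le> card (C' p)" for p
    by (rule survives_count[where j = 0 and P = P and t = t and t' = t' and V = V and V' = V'])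
       (use surv ne SV finC same in \<open>auto simp: C_def C'_def\<close>)
  moreover have "min (card (C' p)) b \<le> card (C p)" for p
    by (rule survives_count[where j = 0 and P = "P\<inverse>" and t = t' and t' = t and V = V' and V' = V])
       (use surv ne' SV finC same in \<open>auto simp: C_def C'_def conv\<close>)
  ultimately have le_C: "min (card (C p)) b \<le> card (C' p)" "min (card (C' p)) b \<le> card (C p)" for p
    by blast+
  have card_C: "card (C p) = card (C' p)" for p
  proof (rule ccontr)
    assume "card (C p) \<noteq> card (C' p)"
    then obtain d e where "card (C d) < card (C' d)" "card (C' e) < card (C e)"
      using fibre_imbalance[of S S' pL p pR, folded C_def C'_def, OF finS card_S'[symmetric]]
      by blast
    \<comment> \<open>The smaller count at \<open>d\<close> and at \<open>e\<close> is at least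
      \<open>b\<close>, so the two classes have at least \<open>2 * b + 1\<close> elements in
      \<open>S\<close>. As \<open>S\<close> has more than \<open>card X\<close> classes, two of them
      have at most \<open>card V - 2 * card X + 1\<close>, which is less.\<close>
    with le_C[of d] le_C[of e] have *: "b \<le> card (C d)" "b < card (C e)" "d \<noteq> e" by auto
    have "card (C d \<union> C e) + card (pL ` S) \<le> card S + card (pL ` (C d \<union> C e))"
      using finS by (intro card_image_surplus) (auto simp: C_def)
    moreover have "card (C d \<union> C e) = card (C d) + card (C e)"
      using \<open>d \<noteq> e\<close> finC by (intro card_Un_disjoint) (auto simp: C_def)
    moreover have "card (pL ` (C d \<union> C e)) \<le> card {d, e}"
      by (intro card_mono) (auto simp: C_def)
    moreover have "card {d, e} \<le> 2" by (simp add: card_insert_if)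
    ultimately show False using * b card_S many by linarith
  qed

  \<comment> \<open>\<open>Q\<close> matches the singleton classes. Being alone in its class, an
    element of \<open>Q\<close> can only be answered by its partner; this is
    \<open>forced\<close>.\<close>
  define Q where "Q = {(y, y'). y \<in> S \<and> y' \<in> S' \<and> pL y = pR y' \<and> card (C (pL y)) = 1}"
  have forced: "w' = y' \<longleftrightarrow> w = y"
    if Q: "(y, y') \<in> Q" and iso: "partial_iso t t' (insert (w, w') P)"
      and w: "w \<in> V" "w' \<in> V'" and eq: "w = y \<or> w' = y'" for y y' w w'
  proof -
    from Q have y: "y \<in> C (pL y)" "y' \<in> C' (pL y)" "card (C (pL y)) = 1" "card (C' (pL y)) = 1"
      using card_C by (auto simp: Q_def C_def C'_def)
    have "w \<in> C (pL y) \<and> w' \<in> C' (pL y)"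
      using same[OF iso w] eq Q by (auto simp: Q_def C_def C'_def)
    with y show ?thesis by (metis card_1_singletonE singletonD)
  qed
  have Q_V: "y \<in> V" "y' \<in> V'" if "(y, y') \<in> Q" for y y' using that SV by (auto simp: Q_def)

  text \<open>A class \<open>{u, w}\<close> may carry a non-symmetric colour \<open>t u w\<close>; recording this colour
    tells the two elements apart.\<close>
  define oL oR
    where "oL v = (if card (C (pL v)) = 2 then t v ` (C (pL v) - {v}) else {})"
      and "oR v' = (if card (C' (pR v')) = 2 then t' v' ` (C' (pR v') - {v'}) else {})" for v v'
  have oL_pair: "oL u = {t u v}"
    if "card (C (pL u)) = 2" "u \<in> S" "v \<in> S" "u \<noteq> v" "pL v = pL u" for u v
  proof -
    have "C (pL u) = {u, v}"
      using that finC by (intro card_seteq[symmetric]) (auto simp: C_def)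
    with that show ?thesis by (auto simp: oL_def)
  qed
  have oR_pair: "oR u = {t' u v}"
    if "card (C' (pR u)) = 2" "u \<in> S'" "v \<in> S'" "u \<noteq> v" "pR v = pR u" for u v
  proof -
    have "C' (pR u) = {u, v}"
      using that finC by (intro card_seteq[symmetric]) (auto simp: C'_def)
    with that show ?thesis by (auto simp: oR_def)
  qed
  have other: "\<exists>w. w \<noteq> v \<and> w \<in> S \<and> pL w = pL v" if "v \<in> S" "card (C (pL v)) \<noteq> 1" for v
  proof (rule ccontr)
    assume "\<not> ?thesis"
    with that have "C (pL v) = {v}" by (auto simp: C_def)
    with that show False by simp
  qed
  have other': "\<exists>w. w \<noteq> v \<and> w \<in> S' \<and> pR w = pR v" if "v \<in> S'" "card (C' (pR v)) \<noteq> 1" for v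
  proof (rule ccontr)
    assume "\<not> ?thesis"
    with that have "C' (pR v) = {v}" by (auto simp: C'_def)
    with that show False by simp
  qed

  \<comment> \<open>The refined type adds the colours towards singleton classes, indexed by the
    pairs in \<open>Q\<close> so that both sides share the index set, and the colour inside a class
    of two.\<close>
  define eL eR where "eL v = (restrict (\<lambda>q. t v (fst q)) Q, oL v)"
    and "eR v' = (restrict (\<lambda>q. t' v' (snd q)) Q, oR v')" for v v'
  have eL_eR: "eL a = eR a'"
    if a: "a \<in> S" "a' \<in> S'" "pL a = pR a'"
      and Qa: "\<And>y y'. (y, y') \<in> Q \<Longrightarrow> t a y = t' a' y'"
      and pair: "card (C (pL a)) = 2 \<Longrightarrow> \<exists>w w'. w \<in> S \<and> w' \<in> S' \<and> w \<noteq> a \<and> w' \<noteq> a' \<and>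
        pL w = pL a \<and> pR w' = pL a \<and> t a w = t' a' w'" for a a'
  proof -
    have "oL a = oR a'"
    proof (cases "card (C (pL a)) = 2")
      case True
      with pair obtain w w' where w: "w \<in> S" "w' \<in> S'" "w \<noteq> a" "w' \<noteq> a'"
        "pL w = pL a" "pR w' = pL a" "t a w = t' a' w'" by blast
      then show ?thesis using oL_pair[of a w] oR_pair[of a' w'] True card_C a by auto
    next
      case False
      then show ?thesis using a card_C by (auto simp: oL_def oR_def)
    qed
    then show ?thesis using Qa by (auto simp: eL_def eR_def restrict_def fun_eq_iff)
  qed
  \<comment> \<open>The single move left tests the refined type: playing \<open>y\<close> forces the
    reply \<open>y'\<close>, and playing the other element of a class of two exhibits the inner
    colour.\<close>
  have step: "a' \<in> S' \<and> pR a' = pL a \<and> eR a' = eL a"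
    if a: "a \<in> S" "a' \<in> V'" and s: "survives t V t' V' 1 (insert (a, a') P)" for a a'
  proof -
    have move: "\<exists>w'\<in>V'. partial_iso t t' (insert (w, w') (insert (a, a') P))" if "w \<in> V" for w
      using s that by simp
    have "partial_iso t t' (insert (a, a') P)" by (rule survives_partial_iso[OF s ne])
    then have a': "a' \<in> S'" "pL a = pR a'" using same a SV by blast+
    have "t a y = t' a' y'" if y: "(y, y') \<in> Q" for y y'
    proof -
      obtain w' where w': "w' \<in> V'" and iso: "partial_iso t t' (insert (y, w') (insert (a, a') P))"
        using move Q_V[OF y] by blast
      have "partial_iso t t' (insert (y, w') P)" using partial_iso_mono[OF iso] by blast
      then have "w' = y'" using forced[OF y] w' Q_V[OF y] by blast
      then show ?thesis using partial_isoD(2)[OF iso, of a a' y w'] by blast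
    qed
    moreover have "\<exists>w w'. w \<in> S \<and> w' \<in> S' \<and> w \<noteq> a \<and> w' \<noteq> a' \<and>
        pL w = pL a \<and> pR w' = pL a \<and> t a w = t' a' w'" if two: "card (C (pL a)) = 2"
    proof -
      obtain w where w: "w \<noteq> a" "w \<in> S" "pL w = pL a"
        using other[of a] two a by auto
      then obtain w' where w': "w' \<in> V'"
        and iso: "partial_iso t t' (insert (w, w') (insert (a, a') P))" using move SV by blast
      have "partial_iso t t' (insert (w, w') P)" using partial_iso_mono[OF iso] by blast
      then have "w' \<in> S'" "pL w = pR w'" using same w w' SV by blast+
      moreover have "w' \<noteq> a'" "t a w = t' a' w'"
        using partial_isoD[OF iso, of a a' w w'] w by blast+
      ultimately show ?thesis using w by metis
    qed
    ultimately have "eL a = eR a'" by (rule eL_eR[OF a(1) a'])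
    then show ?thesis using a' by simp
  qed
  have step': "a \<in> S \<and> pL a = pR a' \<and> eL a = eR a'"
    if a: "a' \<in> S'" "a \<in> V" and s: "survives t' V' t V 1 (insert (a', a) (P\<inverse>))" for a a'
  proof -
    have move: "\<exists>w\<in>V. partial_iso t t' (insert (w, w') (insert (a, a') P))" if "w' \<in> V'" for w'
      using s that by (simp add: conv2)
    have "partial_iso t t' (insert (a, a') P)" using survives_partial_iso[OF s ne'] conv by simp
    then have a': "a \<in> S" "pL a = pR a'" using same a SV by blast+
    have "t a y = t' a' y'" if y: "(y, y') \<in> Q" for y y'
    proof -
      obtain w where w: "w \<in> V" and iso: "partial_iso t t' (insert (w, y') (insert (a, a') P))"
        using move Q_V[OF y] by blast
      have "partial_iso t t' (insert (w, y') P)" using partial_iso_mono[OF iso] by blast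
      then have "w = y" using forced[OF y] w Q_V[OF y] by blast
      then show ?thesis using partial_isoD(2)[OF iso, of a a' w y'] by blast
    qed
    moreover have "\<exists>w w'. w \<in> S \<and> w' \<in> S' \<and> w \<noteq> a \<and> w' \<noteq> a' \<and>
        pL w = pL a \<and> pR w' = pL a \<and> t a w = t' a' w'" if two: "card (C (pL a)) = 2"
    proof -
      obtain w' where w': "w' \<noteq> a'" "w' \<in> S'" "pR w' = pR a'"
        using other'[of a'] two a a' card_C by auto
      then obtain w where w: "w \<in> V"
        and iso: "partial_iso t t' (insert (w, w') (insert (a, a') P))" using move SV by blast
      have "partial_iso t t' (insert (w, w') P)" using partial_iso_mono[OF iso] by blast
      then have "w \<in> S" "pL w = pR w'" using same w w' SV by blast+
      moreover have "w \<noteq> a" "t a w = t' a' w'"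
        using partial_isoD[OF iso, of a a' w w'] w' by blast+
      ultimately show ?thesis using w' a'(2) by metis
    qed
    ultimately have "eL a = eR a'" by (rule eL_eR[OF a'(1) a(1) a'(2)])
    then show ?thesis using a' by simp
  qed

  define E E' where "E p e = {a \<in> C p. eL a = e}" and "E' p e = {a' \<in> C' p. eR a' = e}" for p e
  have b1: "b = (b - 1) + 1" using b2 by simp
  have "min (card (E p e)) (b - 1) \<le> card (E' p e)" for p e
    by (rule survives_count[where j = 1 and P = P and t = t and t' = t' and V = V and V' = V'])
       (use surv b1 ne SV finS step in \<open>auto simp: E_def E'_def C_def C'_def\<close>)
  moreover have "min (card (E' p e)) (b - 1) \<le> card (E p e)" for p e
    by (rule survives_count[where j = 1 and P = "P\<inverse>" and t = t' and t' = t and V = V' and V' = V])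
       (use surv b1 ne' SV finS step' in \<open>auto simp: E_def E'_def C_def C'_def\<close>)
  ultimately have le_E: "min (card (E p e)) (b - 1) \<le> card (E' p e)"
      "min (card (E' p e)) (b - 1) \<le> card (E p e)" for p e
    by blast+
  have card_E: "card (E p e) = card (E' p e)" for p e
  proof (rule ccontr)
    assume "card (E p e) \<noteq> card (E' p e)"
    then obtain d d' where "card (E p d) < card (E' p d)" "card (E' p d') < card (E p d')"
      using fibre_imbalance[of "C p" "C' p" eL e eR, folded E_def E'_def, OF finC card_C] by blast
    \<comment> \<open>With one move reserved, the two parts have at least \<open>2 * b - 1\<close>
      elements together. They lie in one class, which has at most
      \<open>card V - 2 * card X\<close>, again too few.\<close>
    with le_E[where p = p and e = d] le_E[where p = p and e = d']
    have *: "b - 1 \<le> card (E p d)" "b - 1 < card (E p d')" "d \<noteq> d'" by auto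
    have "card (E p d) + card (E p d') = card (E p d \<union> E p d')"
      using \<open>d \<noteq> d'\<close> finC by (intro card_Un_disjoint[symmetric]) (auto simp: E_def)
    also have "\<dots> \<le> card (C p)" using finC by (intro card_mono) (auto simp: E_def)
    finally have "2 * b \<le> card (C p) + 1" using * by linarith
    moreover have "card (C p) + card (pL ` S) \<le> card S + card (pL ` C p)"
      using finS by (intro card_image_surplus) (auto simp: C_def)
    moreover have "card (pL ` C p) \<le> card {p}" by (intro card_mono) (auto simp: C_def)
    ultimately show False using b card_S many by simp
  qed
  have "card {a \<in> S. (pL a, eL a) = d} = card {a' \<in> S'. (pR a', eR a') = d}" for d
  proof -
    have "{a \<in> S. (pL a, eL a) = d} = E (fst d) (snd d)"
      "{a' \<in> S'. (pR a', eR a') = d} = E' (fst d) (snd d)"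
      by (auto simp: E_def E'_def C_def C'_def)
    then show ?thesis using card_E by simp
  qed
  then obtain F where F: "bij_betw F S S'"
    and FF: "\<And>a. a \<in> S \<Longrightarrow> (pR (F a), eR (F a)) = (pL a, eL a)"
    using fibrewise_bij[OF finS, of "\<lambda>a. (pL a, eL a)" "\<lambda>a'. (pR a', eR a')"] by blast
  from FF have Fp: "pR (F a) = pL a" and Fe: "eR (F a) = eL a" if "a \<in> S" for a
    using that by auto
  have FS: "F a \<in> S'" if "a \<in> S" for a using bij_betw_apply[OF F that] .

  have H: "t v\<^sub>1 s = t v\<^sub>2 s"
    if s: "s \<in> S" "card (C (pL s)) \<noteq> 1" and "v\<^sub>1 \<in> S" "v\<^sub>2 \<in> S" "v\<^sub>1 \<noteq> s" "v\<^sub>2 \<noteq> s" "pL v\<^sub>1 = pL v\<^sub>2" for s v\<^sub>1 v\<^sub>2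
  proof -
    obtain w where "w \<noteq> s" "w \<in> S" "pL w = pL s"
      using other[OF s] by auto
    then show ?thesis using that homog[of s w v\<^sub>1 v\<^sub>2] by (auto simp: S_def pL_def)
  qed
  \<comment> \<open>\<open>F\<close> matches singleton classes along \<open>Q\<close>, so this
    colour is an entry of the refined type.\<close>
  have FQ: "t u v = t' (F u) (F v)" if "u \<in> S" "v \<in> S" "card (C (pL v)) = 1" for u v
  proof -
    have "(v, F v) \<in> Q" using that FS Fp by (auto simp: Q_def)
    moreover have "fst (eL u) (v, F v) = fst (eR (F u)) (v, F v)" using Fe[OF \<open>u \<in> S\<close>] by simp
    ultimately show ?thesis by (simp add: eL_def eR_def)
  qed
  have FSS: "t u v = t' (F u) (F v)" if u: "u \<in> S" and v: "v \<in> S" for u v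
  proof -
    consider (eq) "u = v" | (v1) "card (C (pL v)) = 1" | (u1) "card (C (pL u)) = 1"
      | (two) "u \<noteq> v" "card (C (pL u)) = 2" "pL u = pL v"
      | (big) "u \<noteq> v" "card (C (pL u)) \<noteq> 1" "card (C (pL v)) \<noteq> 1"
          "card (C (pL u)) \<noteq> 2 \<or> pL u \<noteq> pL v"
      by blast
    then show ?thesis
    proof cases
      case eq
      then show ?thesis using Fp[OF u] by (simp add: pL_def pR_def profile_def)
    next
      case v1
      then show ?thesis using FQ u v by blast
    next
      case u1
      then have "t v u = t' (F v) (F u)" using FQ u v by blast
      then show ?thesis using sw by metis
    next
      case two
      have "F u \<noteq> F v" using F two(1) u v by (metis bij_betw_inv_into_left)
      moreover have "oL u = oR (F u)" using Fe[OF u] by (simp add: eL_def eR_def)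
      moreover have "oL u = {t u v}" by (rule oL_pair) (use two u v in auto)
      moreover have "card (C' (pR (F u))) = 2" using two(2) by (simp add: Fp[OF u] card_C)
      then have "oR (F u) = {t' (F u) (F v)}"
        using \<open>F u \<noteq> F v\<close> two(3) by (intro oR_pair) (simp_all add: FS Fp u v)
      ultimately show ?thesis by simp
    next
      case big
      have uv: "F u \<noteq> F v" using F big(1) u v by (metis bij_betw_inv_into_left)
      have FV: "F u \<in> V'" "F v \<in> V'" using FS u v SV by blast+
      \<comment> \<open>Playing \<open>F u\<close> and \<open>F v\<close> yields
        \<open>w\<^sub>1\<close> and \<open>w\<^sub>2\<close> in the classes of \<open>u\<close> and
        \<open>v\<close> with the same mutual colour; homogeneity then carries this colour over to
        \<open>u\<close> and \<open>v\<close>.\<close>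
      have "survives t' V' t V (Suc (Suc 0)) (P\<inverse>)"
        by (rule survives_le[OF surv(2) ne']) (use b2 in simp)
      then have "\<forall>a\<in>V'. \<exists>w\<^sub>1\<in>V. \<forall>c\<in>V'. \<exists>w\<^sub>2\<in>V.
          partial_iso t t' (insert (w\<^sub>2, c) (insert (w\<^sub>1, a) P))"
        by (simp add: conv2)
      with FV obtain w\<^sub>1 w\<^sub>2 where w: "w\<^sub>1 \<in> V" "w\<^sub>2 \<in> V"
        and iso: "partial_iso t t' (insert (w\<^sub>2, F v) (insert (w\<^sub>1, F u) P))"
        by blast
      have "partial_iso t t' (insert (w\<^sub>1, F u) P)" "partial_iso t t' (insert (w\<^sub>2, F v) P)"
        using partial_iso_mono[OF iso] by blast+
      from same[OF this(1) w(1) FV(1)] same[OF this(2) w(2) FV(2)]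
      have w_S: "w\<^sub>1 \<in> S" "w\<^sub>2 \<in> S" and w_p: "pL w\<^sub>1 = pL u" "pL w\<^sub>2 = pL v"
        using FS Fp u v by auto
      have w_ne: "w\<^sub>1 \<noteq> w\<^sub>2" and w_t: "t w\<^sub>1 w\<^sub>2 = t' (F u) (F v)"
        using partial_isoD[OF iso, of w\<^sub>1 "F u" w\<^sub>2 "F v"] uv by blast+
      have "t w\<^sub>1 w\<^sub>2 = t u v"
      proof (cases "w\<^sub>2 = u")
        case False
        have "t w\<^sub>1 w\<^sub>2 = t u w\<^sub>2" using H[of w\<^sub>2 w\<^sub>1 u] False w_S w_p w_ne u big by auto
        also have "t w\<^sub>2 u = t v u" using H[of u w\<^sub>2 v] False w_S w_p u v big by auto
        then have "t u w\<^sub>2 = t u v" using sw(1) by metis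
        finally show ?thesis .
      next
        case True
        then have same_class: "pL u = pL v" using w_p by simp
        \<comment> \<open>The common class has at least three elements. A third one,
          \<open>z\<close>, allows one entry of the pair to be exchanged at a time without the two
          entries ever coinciding.\<close>
        have "\<exists>z\<in>C (pL u). z \<noteq> u \<and> z \<noteq> v"
        proof (rule ccontr)
          assume "\<not> ?thesis"
          then have "C (pL u) = {u, v}" using u v same_class by (auto simp: C_def)
          then show False using big same_class by simp
        qed
        then obtain z where z: "z \<in> S" "pL z = pL u" "z \<noteq> u" "z \<noteq> v" by (auto simp: C_def)
        have "t w\<^sub>1 w\<^sub>2 = t z u" using H[of u w\<^sub>1 z] True w_S w_p w_ne z u big by auto
        also have "t u z = t v z" using H[of z u v] z u v big same_class by auto
        then have "t z u = t z v" using sw(1) by metis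
        also have "t z v = t u v" using H[of v z u] z u v big same_class by auto
        finally show ?thesis .
      qed
      then show ?thesis using w_t by simp
    qed
  qed
  have FX: "t v x = t' (F v) (h x)" if "v \<in> S" "x \<in> X" for v x
  proof -
    have "snd (pL v) x = snd (pR (F v)) x" using Fp[OF that(1)] by simp
    then show ?thesis using that(2) by (simp add: pL_def pR_def profile_def)
  qed
  have XX: "t x y = t' (h x) (h y)" if "x \<in> X" "y \<in> X" for x y
    using partial_isoD(2)[OF iso0 P_mem P_mem] that by blast

  define f where "f v = (if v \<in> X then h v else F v)" for v
  have "bij_betw f X (h ` X)" using inj_h by (auto simp: bij_betw_def f_def inj_on_def)
  moreover have "bij_betw f S S'"
    using F by (subst bij_betw_cong[of S f F]) (auto simp: f_def S_def)
  ultimately have "bij_betw f (X \<union> S) (h ` X \<union> S')"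
    by (rule bij_betw_combine) (auto simp: S'_def)
  then have "bij_betw f V V'" using X h by (simp add: S_def S'_def Un_absorb1)
  moreover have "t' (f u) (f v) = t u v" if "u \<in> V" "v \<in> V" for u v
  proof -
    have "u \<in> X \<or> u \<in> S" "v \<in> X \<or> v \<in> S" using that by (auto simp: S_def)
    moreover have "t u v = t' (h u) (F v)" if "u \<in> X" "v \<in> S"
      using FX[OF that(2,1)] sw by metis
    ultimately show ?thesis using FX XX FSS by (auto simp: f_def S_def)
  qed
  ultimately show ?thesis by blast
qed

section \<open>Colours of pairs\<close>

text \<open>The word \<open>ws\<close> marks which arguments of the \<open>i\<close>-th relation are \<open>u\<close> and which are \<open>v\<close>.\<close>

definition colour :: "vocab \<Rightarrow> 'a struct \<Rightarrow> 'a \<Rightarrow> 'a \<Rightarrow> (nat \<times> bool list) set" where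
  "colour \<sigma> G u v = {(i, ws). i < length \<sigma> \<and> length ws = \<sigma> ! i \<and>
     map (\<lambda>w. if w then u else v) ws \<in> interp G i}"

text \<open>Exchanging \<open>u\<close> and \<open>v\<close> complements every marking word. This
  provides one \<open>sw\<close> for both structures.\<close>

lemma colour_swap: "colour \<sigma> G v u = (\<lambda>(i, ws). (i, map Not ws)) ` colour \<sigma> G u v"
proof -
  have sub: "(\<lambda>(i, ws). (i, map Not ws)) ` colour \<sigma> G u v \<subseteq> colour \<sigma> G v u" for u v
  proof clarify
    fix i ws assume "(i, ws) \<in> colour \<sigma> G u v"
    moreover have "map (\<lambda>w. if w then v else u) (map Not ws) = map (\<lambda>w. if w then u else v) ws"
      by simp
    ultimately show "(i, map Not ws) \<in> colour \<sigma> G v u" by (simp add: colour_def del: map_map)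
  qed
  have "colour \<sigma> G v u = (\<lambda>(i, ws). (i, map Not ws)) ` (\<lambda>(i, ws). (i, map Not ws)) ` colour \<sigma> G v u"
    by (force simp: image_iff comp_def)
  then show ?thesis using sub[of u v] sub[of v u] by blast
qed

text \<open>Tuples have one or two entries, and the words \<open>[True]\<close> and
  \<open>[True, False]\<close> tell whether they lie in a relation.\<close>

lemma isomorphic_if_colour_preserving:
  assumes "vocabulary \<sigma>" "\<forall>k\<in>set \<sigma>. k \<le> 2"
    and f: "bij_betw f (univ G) (univ G')"
    and colour: "\<And>u v. u \<in> univ G \<Longrightarrow> v \<in> univ G \<Longrightarrow> colour \<sigma> G' (f u) (f v) = colour \<sigma> G u v"
  shows "isomorphic \<sigma> G G'"
proof -
  have "xs \<in> interp G i \<longleftrightarrow> map f xs \<in> interp G' i"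
    if i: "i < length \<sigma>" and xs: "length xs = \<sigma> ! i" "set xs \<subseteq> univ G" for i xs
  proof -
    have "\<sigma> ! i \<in> set \<sigma>" using i by simp
    then have "0 < length xs" "length xs \<le> 2" using assms(1,2) xs by (auto simp: vocabulary_def)
    then consider u where "xs = [u]" | u v where "xs = [u, v]"
      by (cases xs; cases "tl xs") auto
    then show ?thesis
    proof cases
      case 1
      have "(i, [True]) \<in> colour \<sigma> G' (f u) (f u) \<longleftrightarrow> (i, [True]) \<in> colour \<sigma> G u u"
        using colour 1 xs by simp
      then show ?thesis using 1 i xs by (simp add: colour_def)
    next
      case 2
      have "(i, [True, False]) \<in> colour \<sigma> G' (f u) (f v) \<longleftrightarrow> (i, [True, False]) \<in> colour \<sigma> G u v"
        using colour 2 xs by simp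
      then show ?thesis using 2 i xs by (simp add: colour_def)
    qed
  qed
  then show ?thesis using f unfolding isomorphic_def by blast
qed

section \<open>Formulas from Spoiler's wins\<close>

text \<open>Variable \<open>i\<close> denotes the \<open>i\<close>-th element picked, counting from
  0. The set \<open>W\<close> of admissible words controls rank and alternations at once.\<close>

definition separated ::
    "vocab \<Rightarrow> quant list set \<Rightarrow> 'a struct \<Rightarrow> 'b struct \<Rightarrow> 'a list \<Rightarrow> 'b list \<Rightarrow> bool" where
  "separated \<sigma> W G G' as bs \<longleftrightarrow> (\<exists>\<phi>. fm_over \<sigma> \<phi> \<and> free_vars \<phi> \<subseteq> {..<length as} \<and>
     Nest \<phi> \<subseteq> W \<and> sat G ((!) as) \<phi> \<and> \<not> sat G' ((!) bs) \<phi>)"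

lemma separated_mono: "separated \<sigma> W G G' as bs \<Longrightarrow> W \<subseteq> W' \<Longrightarrow> separated \<sigma> W' G G' as bs"
  unfolding separated_def by blast

lemma separated_dual:
  assumes "separated \<sigma> W G' G bs as" "length as = length bs"
  shows "separated \<sigma> (map dual ` W) G G' as bs"
proof -
  from assms obtain \<phi> where "fm_over \<sigma> \<phi>" "free_vars \<phi> \<subseteq> {..<length as}" "Nest \<phi> \<subseteq> W"
    "sat G' ((!) bs) \<phi>" "\<not> sat G ((!) as) \<phi>" unfolding separated_def by auto
  then have "fm_over \<sigma> (Neg \<phi>) \<and> free_vars (Neg \<phi>) \<subseteq> {..<length as} \<and>
      Nest (Neg \<phi>) \<subseteq> map dual ` W \<and> sat G ((!) as) (Neg \<phi>) \<and> \<not> sat G' ((!) bs) (Neg \<phi>)"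
    by (simp add: image_mono)
  then show ?thesis unfolding separated_def by blast
qed

text \<open>A failure is witnessed by an atom about two positions; if its polarity is wrong, its
  negation serves, whose only word is still empty.\<close>

lemma separated_if_not_partial_iso:
  assumes "\<not> partial_iso (colour \<sigma> G) (colour \<sigma> G') (set (zip as bs))" "length as = length bs"
  shows "separated \<sigma> {[]} G G' as bs"
proof -
  have *: "separated \<sigma> {[]} G G' as bs"
    if "fm_over \<sigma> \<phi>" "free_vars \<phi> \<subseteq> {..<length as}" "Nest \<phi> = {[]}"
      "sat G ((!) as) \<phi> \<noteq> sat G' ((!) bs) \<phi>" for \<phi>
  proof (cases "sat G ((!) as) \<phi>")
    case True
    then show ?thesis using that unfolding separated_def by blast
  next
    case False
    then have "separated \<sigma> {[]} G' G bs as" using that assms(2) unfolding separated_def by auto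
    then show ?thesis using separated_dual[OF _ assms(2)] by fastforce
  qed
  from assms(1) obtain u u' v v' where
    pairs: "(u, u') \<in> set (zip as bs)" "(v, v') \<in> set (zip as bs)"
    and diff: "(u = v) \<noteq> (u' = v') \<or> colour \<sigma> G u v \<noteq> colour \<sigma> G' u' v'"
    unfolding partial_iso_def by blast
  from pairs obtain i j where ij: "i < length as" "j < length as"
    and uv: "u = as ! i" "u' = bs ! i" "v = as ! j" "v' = bs ! j"
    using assms(2) by (auto simp: in_set_zip)
  show ?thesis
  proof (cases "(u = v) = (u' = v')")
    case False
    then show ?thesis using ij uv by (intro *[of "Eq i j"]) auto
  next
    case True
    then obtain r ws where rws: "(r, ws) \<in> colour \<sigma> G u v \<longleftrightarrow> (r, ws) \<notin> colour \<sigma> G' u' v'"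
      using diff by (metis (no_types) set_eqI surj_pair)
    \<comment> \<open>The marking word becomes a list of variables.\<close>
    let ?idx = "map (\<lambda>w. if w then i else j) ws"
    have "map ((!) as) ?idx = map (\<lambda>w. if w then u else v) ws"
      "map ((!) bs) ?idx = map (\<lambda>w. if w then u' else v') ws"
      using uv by auto
    moreover have "r < length \<sigma>" "length ws = \<sigma> ! r" using rws by (auto simp: colour_def)
    ultimately show ?thesis
      using rws ij by (intro *[of "Rel r ?idx"]) (auto simp: colour_def simp del: map_map)
  qed
qed

lemma foldr_Conj:
  "fm_over \<sigma> (foldr Conj \<psi>s \<psi>) \<longleftrightarrow> (\<forall>\<phi>\<in>set (\<psi> # \<psi>s). fm_over \<sigma> \<phi>)"
  "sat G e (foldr Conj \<psi>s \<psi>) \<longleftrightarrow> (\<forall>\<phi>\<in>set (\<psi> # \<psi>s). sat G e \<phi>)"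
  "free_vars (foldr Conj \<psi>s \<psi>) = (\<Union>\<phi>\<in>set (\<psi> # \<psi>s). free_vars \<phi>)"
  "Nest (foldr Conj \<psi>s \<psi>) = (\<Union>\<phi>\<in>set (\<psi> # \<psi>s). Nest \<phi>)"
  by (induction \<psi>s) auto

text \<open>Each reply is refuted by some formula true at \<open>a\<close>. Since
  \<open>univ G'\<close> is finite, these formulas have a conjunction, which \<open>a\<close>
  satisfies and no reply does.\<close>

lemma separated_Exi:
  assumes len: "length as = length bs" and V': "finite (univ G')" "univ G' \<noteq> {}"
    and a: "a \<in> univ G"
    and sep: "\<And>a'. a' \<in> univ G' \<Longrightarrow> separated \<sigma> W G G' (as @ [a]) (bs @ [a'])"
  shows "separated \<sigma> ((#) QE ` W) G G' as bs"
proof -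
  let ?ok = "\<lambda>\<phi>. fm_over \<sigma> \<phi> \<and> free_vars \<phi> \<subseteq> {..<Suc (length as)} \<and> Nest \<phi> \<subseteq> W \<and>
    sat G ((!) (as @ [a])) \<phi>"
  have "\<exists>\<phi>. ?ok \<phi> \<and> \<not> sat G' ((!) (bs @ [a'])) \<phi>" if "a' \<in> univ G'" for a'
    using sep[OF that] unfolding separated_def by auto
  then obtain \<Phi> where \<Phi>: "\<And>a'. a' \<in> univ G' \<Longrightarrow> ?ok (\<Phi> a') \<and> \<not> sat G' ((!) (bs @ [a'])) (\<Phi> a')"
    by metis
  obtain c cs where cs: "univ G' = set (c # cs)"
    using V' by (metis finite_list list.exhaust set_empty)
  define \<psi> where "\<psi> = foldr Conj (map \<Phi> cs) (\<Phi> c)"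
  have set: "set (\<Phi> c # map \<Phi> cs) = \<Phi> ` univ G'" using cs by simp
  have \<psi>: "?ok \<psi>" "\<And>a'. a' \<in> univ G' \<Longrightarrow> \<not> sat G' ((!) (bs @ [a'])) \<psi>"
    using \<Phi> unfolding \<psi>_def foldr_Conj set by blast+
  \<comment> \<open>On variables up to \<open>length as\<close>, the only ones free in
    \<open>\<psi>\<close>, updating the assignment agrees with appending to the list.\<close>
  have upd: "sat H (((!) xs)(length as := x)) \<psi> = sat H ((!) (xs @ [x])) \<psi>"
    if "length xs = length as" for H :: "'z struct" and xs x
    using \<psi>(1) that by (intro sat_cong_free_vars) (auto simp: nth_append less_Suc_eq)
  have "fm_over \<sigma> (Exi (length as) \<psi>)" "Nest (Exi (length as) \<psi>) \<subseteq> (#) QE ` W"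
    using \<psi>(1) by auto
  moreover have "free_vars (Exi (length as) \<psi>) \<subseteq> {..<length as}"
    using \<psi>(1) by (auto simp: less_Suc_eq)
  moreover have "sat G ((!) as) (Exi (length as) \<psi>)" using \<psi>(1) a upd[of as G a] by auto
  moreover have "\<not> sat G' ((!) bs) (Exi (length as) \<psi>)" using \<psi>(2) upd[of bs G'] len by auto
  ultimately show ?thesis unfolding separated_def by blast
qed

lemma separated_if_not_survives:
  assumes "\<not> survives (colour \<sigma> G) (univ G) (colour \<sigma> G') (univ G') b (set (zip as bs))"
    and "length as = length bs" "finite (univ G')" "univ G' \<noteq> {}"
  shows "separated \<sigma> {replicate b QE} G G' as bs"
  using assms(1,2)
proof (induction b arbitrary: as bs)
  case 0
  then show ?case using separated_if_not_partial_iso by simp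
next
  case (Suc b)
  from Suc.prems(1) obtain a where a: "a \<in> univ G" and
    "\<And>a'. a' \<in> univ G' \<Longrightarrow>
      \<not> survives (colour \<sigma> G) (univ G) (colour \<sigma> G') (univ G') b (insert (a, a') (set (zip as bs)))"
    by auto
  then have "separated \<sigma> {replicate b QE} G G' (as @ [a]) (bs @ [a'])" if "a' \<in> univ G'" for a'
    using that Suc.prems(2) by (intro Suc.IH) auto
  from separated_Exi[OF Suc.prems(2) assms(3,4) a this] show ?case by simp
qed

text \<open>\<open>W\<close> may hold several words, so the continuation may depend on the replies
  \<open>ys\<close>.\<close>

lemma separated_block:
  assumes "length as = length bs" "finite (univ G')" "univ G' \<noteq> {}" "set xs \<subseteq> univ G"
    and "\<And>ys. length ys = length xs \<Longrightarrow> set ys \<subseteq> univ G' \<Longrightarrow>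
      separated \<sigma> W G G' (as @ xs) (bs @ ys)"
  shows "separated \<sigma> ((@) (replicate (length xs) QE) ` W) G G' as bs"
  using assms(1,4,5)
proof (induction xs arbitrary: as bs)
  case Nil
  from Nil.prems(3)[of "[]"] show ?case by simp
next
  case (Cons x xs)
  have "separated \<sigma> ((@) (replicate (length xs) QE) ` W) G G' (as @ [x]) (bs @ [a'])"
    if "a' \<in> univ G'" for a'
  proof (rule Cons.IH)
    fix ys assume "length ys = length xs" "set ys \<subseteq> univ G'"
    with Cons.prems(3)[of "a' # ys"] that
    show "separated \<sigma> W G G' ((as @ [x]) @ xs) ((bs @ [a']) @ ys)" by simp
  qed (use Cons.prems in auto)
  from separated_Exi[OF Cons.prems(1) assms(2,3) _ this] Cons.prems(2) show ?case
    by (simp add: image_image)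
qed

text \<open>The letter can change only right after index \<open>k - 1\<close>; for
  \<open>k = 0\<close> it never changes.\<close>

lemma alternations_two_blocks: "alternations (replicate k p @ replicate b q) \<le> 1"
proof -
  have "{i. Suc i < length (replicate k p @ replicate b q) \<and>
      (replicate k p @ replicate b q) ! i \<noteq> (replicate k p @ replicate b q) ! Suc i} \<subseteq> {k - 1}"
    by (auto simp: nth_append split: if_splits)
  from card_mono[OF _ this] show ?thesis unfolding alternations_def by simp
qed

lemma D_le_if_separated:
  assumes sep: "separated \<sigma> W G G' [] []"
    and W: "\<And>w. w \<in> W \<Longrightarrow> alternations w \<le> k \<and> length w \<le> r"
  shows "D k \<sigma> G G' \<le> enat r"
proof -
  from sep obtain \<phi> where \<phi>: "fm_over \<sigma> \<phi>" "free_vars \<phi> = {}" "Nest \<phi> \<subseteq> W"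
    "sat G ((!) []) \<phi>" "\<not> sat G' ((!) []) \<phi>" unfolding separated_def by auto
  have "sat H e \<phi> = sat H e' \<phi>" for H :: "'z struct" and e e'
    using \<phi>(2) by (intro sat_cong_free_vars) simp
  then have "distinguishes \<sigma> \<phi> G G'"
    using \<phi> unfolding distinguishes_def true_on_def by (metis (no_types))
  moreover have "alternation_number \<phi> \<le> k"
    using W \<phi>(3) by (auto simp: alternation_number_def)
  ultimately have "D k \<sigma> G G' \<le> enat (quantifier_rank \<phi>)"
    unfolding D_def by (intro INF_lower) simp
  also have "quantifier_rank \<phi> \<le> r" using W \<phi>(3) by (auto simp: quantifier_rank_def)
  finally show ?thesis by simp
qed

section \<open>Spoiler's strategy and the bound\<close>

theorem theorem8p2:
  fixes \<sigma> :: vocab and G :: "'a struct" and G' :: "'b struct" and n :: nat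
  assumes "vocabulary \<sigma>"
    and "\<forall>k\<in>set \<sigma>. k \<le> 2"
    and "is_structure \<sigma> G"
    and "is_structure \<sigma> G'"
    and "\<not> isomorphic \<sigma> G G'"
    and "order_of G = n"
    and "order_of G' = n"
  shows "ereal_of_enat (D 1 \<sigma> G G') \<le> ereal ((real n + 3) / 2)"
proof -
  let ?t = "colour \<sigma> G" and ?t' = "colour \<sigma> G'" and ?V = "univ G" and ?V' = "univ G'"
  have fin: "finite ?V" "finite ?V'" using assms(3,4) by (auto simp: is_structure_def)
  have not_iso: "\<not> (\<exists>f. bij_betw f ?V ?V' \<and> (\<forall>u\<in>?V. \<forall>v\<in>?V. ?t' (f u) (f v) = ?t u v))"
    using isomorphic_if_colour_preserving[OF assms(1,2)] assms(5) by blast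
  have ne: "?V \<noteq> {}"
  proof
    assume "?V = {}"
    moreover from this have "?V' = {}" using fin assms(6,7) by auto
    ultimately show False using not_iso by (auto simp: bij_betw_def)
  qed
  then have ne': "?V' \<noteq> {}" using fin assms(6,7) by auto
  obtain X where X: "X \<subseteq> ?V" "card X < card (profile ?t X ` (?V - X))"
    and homog: "\<And>u w v\<^sub>1 v\<^sub>2. \<lbrakk>{u, w, v\<^sub>1, v\<^sub>2} \<subseteq> ?V - X; u \<notin> {w, v\<^sub>1, v\<^sub>2};
          profile ?t X u = profile ?t X w; profile ?t X v\<^sub>1 = profile ?t X v\<^sub>2\<rbrakk>
        \<Longrightarrow> ?t v\<^sub>1 u = ?t v\<^sub>2 u"
    using profile_base[OF fin(1) ne, of ?t] by metis
  have "card (profile ?t X ` (?V - X)) \<le> card (?V - X)" using fin by (simp add: card_image_le)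
  also have "\<dots> = n - card X" using X(1) fin assms(6) by (simp add: card_Diff_subset finite_subset)
  finally have k: "2 * card X + 1 \<le> n" using X(2) by linarith
  \<comment> \<open>Rounding \<open>(n + 3) / 2\<close> down still leaves at least
    \<open>(n + 2) / 2\<close> moves in all, as \<open>survives_imp_iso\<close> demands.\<close>
  define b where "b = (n + 3) div 2 - card X"
  have b: "card X + b = (n + 3) div 2" using k by (simp add: b_def)
  then have b': "card ?V + 2 \<le> 2 * card X + 2 * b" using assms(6) by presburger
  obtain xs where xs: "set xs = X" "distinct xs"
    using finite_distinct_list finite_subset[OF X(1) fin(1)] by blast
  have len_xs: "length xs = card X" using xs distinct_card by metis
  \<comment> \<open>After \<open>X\<close>, a win in \<open>G\<close> gives an existential block,
    and a win in \<open>G'\<close>, once negated, a universal one.\<close>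
  let ?W = "{replicate b QE, replicate b QA}"
  have "separated \<sigma> ((@) (replicate (length xs) QE) ` ?W) G G' [] []"
  proof (rule separated_block)
    fix ys assume ys: "length ys = length xs" "set ys \<subseteq> ?V'"
    \<comment> \<open>As \<open>xs\<close> is distinct, the replies form a function on
      \<open>X\<close>; its values elsewhere are irrelevant.\<close>
    define h where "h x = the (map_of (zip xs ys) x)" for x
    have "map h xs = ys"
      using ys(1) xs(2) by (intro nth_equalityI) (simp_all add: h_def map_of_zip_nth)
    moreover have "set (zip xs (map h xs)) = (\<lambda>x. (x, h x)) ` X"
      unfolding xs(1)[symmetric] by (induction xs) auto
    ultimately have zip: "set (zip xs ys) = (\<lambda>x. (x, h x)) ` X" and h: "h ` X \<subseteq> ?V'"
      using ys(2) xs(1) by auto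
    have zip': "set (zip ys xs) = ((\<lambda>x. (x, h x)) ` X)\<inverse>"
      using zip by (subst zip_commute) (auto simp: image_iff)
    have "\<not> (survives ?t ?V ?t' ?V' b (set (zip xs ys)) \<and> survives ?t' ?V' ?t ?V b (set (zip ys xs)))"
    proof
      assume surv: "survives ?t ?V ?t' ?V' b (set (zip xs ys)) \<and>
        survives ?t' ?V' ?t ?V b (set (zip ys xs))"
      have "\<exists>f. bij_betw f ?V ?V' \<and> (\<forall>u\<in>?V. \<forall>v\<in>?V. ?t' (f u) (f v) = ?t u v)"
      proof (rule survives_imp_iso[OF fin _ X _ colour_swap colour_swap h refl b'])
        show "card ?V = card ?V'" using assms(6,7) by simp
        show "survives ?t ?V ?t' ?V' b ((\<lambda>x. (x, h x)) ` X)"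
          "survives ?t' ?V' ?t ?V b (((\<lambda>x. (x, h x)) ` X)\<inverse>)"
          using surv unfolding zip zip' by blast+
      qed (rule homog)
      with not_iso show False by contradiction
    qed
    then consider "\<not> survives ?t ?V ?t' ?V' b (set (zip xs ys))"
      | "\<not> survives ?t' ?V' ?t ?V b (set (zip ys xs))"
      by blast
    then have "separated \<sigma> ?W G G' xs ys"
    proof cases
      case 1
      from separated_if_not_survives[OF 1 ys(1)[symmetric] fin(2) ne']
      show ?thesis by (rule separated_mono) simp
    next
      case 2
      from separated_dual[OF separated_if_not_survives[OF 2 ys(1) fin(1) ne] ys(1)[symmetric]]
      show ?thesis by (rule separated_mono) simp
    qed
    then show "separated \<sigma> ?W G G' ([] @ xs) ([] @ ys)" by simp
  qed (use fin ne' xs X in auto)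
  then have "D 1 \<sigma> G G' \<le> enat (card X + b)"
    by (rule D_le_if_separated) (use alternations_two_blocks len_xs in auto)
  then have "ereal_of_enat (D 1 \<sigma> G G') \<le> ereal_of_enat (enat (card X + b))"
    by (simp only: ereal_of_enat_le_iff)
  also have "\<dots> \<le> ereal ((real n + 3) / 2)" unfolding b by simp
  finally show ?thesis .
qed

end
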